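(* Let $n\ge 2$ and let $M=[m_{ij}]\in\mathbb{R}^{n\times n}$ be a $B$-matrix, written as $M=B^{+}+C$ with $B^{+}=[b_{ij}]$, $b_{ij}=m_{ij}-r_i^{+}$, and $r_i^{+}=\max\left(\{0\}\cup\{m_{ij}: j\neq i\}\right)$. For $i\in\{1,\dots,n\}$ let $$\bar{\beta}_i=b_{ii}-\sum_{j=i+1}^{n}|b_{ij}|\,l_i(B^{+}),\qquad \widehat{\beta}_i=b_{ii}-\sum_{k=i+1}^{n}|b_{ik}|\,\tilde{m}_{ki}(B^{+}),$$ with $l_i(B^+)$ and $\tilde m_{ki}(B^+)$ as defined in the context. Then $$\sum_{i=1}^{n}\frac{n-1}{\min\{\widehat{\beta}_i,1\}}\prod_{j=1}^{i-1}\frac{b_{jj}}{\bar{\beta}_j}\le \sum_{i=1}^{n}\frac{n-1}{\min\{\bar{\beta}_i,1\}}\prod_{j=1}^{i-1}\frac{b_{jj}}{\bar{\beta}_j},$$ where the products equal $1$ when $i=1$.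
   Context: Let $N=\{1,\dots,n\}$. A matrix $M=[m_{ij}]\in\mathbb{R}^{n\times n}$ is a $B$-matrix if for each $i\in N$: $\sum_{k\in N}m_{ik}>0$ and $\frac1n\sum_{k\in N}m_{ik}>m_{ij}$ for every $j\in N$ with $j\ne i$. In the decomposition $M=B^{+}+C$, the matrix $C$ has all entries of row $i$ equal to $r_i^{+}$. For a $B$-matrix, $B^+$ is strictly diagonally dominant by rows with positive diagonal entries. Define, for $k\in N$, $$l_k(B^{+})=\max_{k\le i\le n}\left\{\frac{1}{|b_{ii}|}\sum_{\substack{j=k\\ j\ne i}}^{n}|b_{ij}|\right\},$$ and, for $i\ne j$, $$\tilde m_{ij}(B^{+})=\frac{1}{b_{ii}}\left(|b_{ij}|+\sum_{\substack{k=j+1\\ k\ne i}}^{n}|b_{ik}|\cdot\max_{h\ne k}\left\{\frac{|b_{kh}|}{b_{kk}-\sum_{\substack{l=h+1\\ l\ne k}}^{n}|b_{kl}|}\right\}\right).$$ Empty sums are $0$. *)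

theory Defs
  imports Complex_Main "Jordan_Normal_Form.Matrix"
begin

text \<open>
  Rows and columns of an \<open>n \<times> n\<close> matrix are indexed by \<open>0, \<dots>, n - 1\<close>, so an index
  \<open>i\<close> here is the index \<open>i + 1\<close> of \<open>N = {1, \<dots>, n}\<close>. Under this shift the index range
  \<open>j + 1, \<dots>, n\<close> (strictly after \<open>j\<close>) becomes \<open>{j<..<n}\<close>, the range \<open>k, \<dots>, n\<close> becomes
  \<open>{k..<n}\<close>, and the range \<open>1, \<dots>, i - 1\<close> (strictly before \<open>i\<close>) becomes \<open>{..<i}\<close>.
\<close>

definition B_matrix :: "real mat \<Rightarrow> bool" where
  "B_matrix M \<longleftrightarrow> square_mat M \<and>
     (\<forall>i < dim_row M.
        (\<Sum>k<dim_row M. M $$ (i, k)) > 0 \<and>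
        (\<forall>j < dim_row M. j \<noteq> i \<longrightarrow>
           (1 / real (dim_row M)) * (\<Sum>k<dim_row M. M $$ (i, k)) > M $$ (i, j)))"

definition r_plus :: "real mat \<Rightarrow> nat \<Rightarrow> real" where
  "r_plus M i = Max ({0} \<union> {M $$ (i, j) |j. j < dim_col M \<and> j \<noteq> i})"

definition B_plus :: "real mat \<Rightarrow> real mat" where
  "B_plus M = mat (dim_row M) (dim_col M) (\<lambda>(i, j). M $$ (i, j) - r_plus M i)"

definition C_part :: "real mat \<Rightarrow> real mat" where
  "C_part M = mat (dim_row M) (dim_col M) (\<lambda>(i, j). r_plus M i)"

lemma B_plus_decomposition: "M = B_plus M + C_part M"
  by (rule eq_matI) (auto simp: B_plus_def C_part_def)

definition l_max :: "real mat \<Rightarrow> nat \<Rightarrow> real" where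
  "l_max B k = Max {(1 / \<bar>B $$ (i, i)\<bar>) * (\<Sum>j\<in>{k..<dim_row B} - {i}. \<bar>B $$ (i, j)\<bar>) |i.
     k \<le> i \<and> i < dim_row B}"

text \<open>
  The inner maximum ranges over all \<open>h \<noteq> k\<close> of the whole index set, a nonempty set
  when \<open>n \<ge> 2\<close>.
\<close>

definition m_tilde :: "real mat \<Rightarrow> nat \<Rightarrow> nat \<Rightarrow> real" where
  "m_tilde B i j = (1 / B $$ (i, i)) *
     (\<bar>B $$ (i, j)\<bar> +
      (\<Sum>k\<in>{j<..<dim_row B} - {i}. \<bar>B $$ (i, k)\<bar> *
         Max {\<bar>B $$ (k, h)\<bar> /
                (B $$ (k, k) - (\<Sum>l\<in>{h<..<dim_row B} - {k}. \<bar>B $$ (k, l)\<bar>)) |h.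
              h < dim_row B \<and> h \<noteq> k}))"

definition beta_bar :: "real mat \<Rightarrow> nat \<Rightarrow> real" where
  "beta_bar B i = B $$ (i, i) - (\<Sum>j\<in>{i<..<dim_row B}. \<bar>B $$ (i, j)\<bar> * l_max B i)"

definition beta_hat :: "real mat \<Rightarrow> nat \<Rightarrow> real" where
  "beta_hat B i = B $$ (i, i) - (\<Sum>k\<in>{i<..<dim_row B}. \<bar>B $$ (i, k)\<bar> * m_tilde B k i)"

end

theory Submission imports Defs
begin

text \<open>
  The two sums differ only in \<open>beta_hat\<close> against \<open>beta_bar\<close> inside the minimum, so it suffices
  that \<open>0 < beta_bar B i \<le> beta_hat B i\<close> and that all the products are nonnegative.

  Everything rests on the strict row dominance of \<open>B_plus M\<close> with positive diagonal
  (\<open>B_plus_dominant\<close>): off the diagonal its entries are nonpositive, while each row sum stays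
  positive, because \<open>r_plus M i\<close> is smaller than the mean of row \<open>i\<close> of a \<open>B\<close>-matrix.
  Dominance has two consequences.

  \<^item> Each ratio in the inner maximum of \<open>m_tilde\<close> is at most \<open>1\<close>: its numerator \<open>\<bar>b\<^sub>k\<^sub>h\<bar>\<close> and the sum
    subtracted in its denominator are disjoint pieces of the off-diagonal part of row \<open>k\<close>.
    Replacing these maxima by \<open>1\<close> turns \<open>m_tilde B k i\<close> into one of the quotients over which
    \<open>l_max B i\<close> is the maximum, so \<open>m_tilde B k i \<le> l_max B i\<close> for \<open>k > i\<close>
    (\<open>m_tilde_le_l_max\<close>), and hence \<open>beta_bar B i \<le> beta_hat B i\<close>.
  \<^item> Those quotients are all at most \<open>1\<close>, so \<open>beta_bar B i\<close> is at least \<open>b\<^sub>i\<^sub>i\<close> minus an off-diagonal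
    partial row sum, which is positive.
\<close>

definition dominant_rows :: "nat \<Rightarrow> real mat \<Rightarrow> bool" where
  "dominant_rows n B \<longleftrightarrow>
     dim_row B = n \<and> (\<forall>i<n. (\<Sum>j\<in>{..<n} - {i}. \<bar>B $$ (i, j)\<bar>) < B $$ (i, i))"

lemma dominant_rows_partial_sum:
  assumes "dominant_rows n B" "i < n" "J \<subseteq> {..<n} - {i}"
  shows "(\<Sum>j\<in>J. \<bar>B $$ (i, j)\<bar>) < B $$ (i, i)"
proof -
  have "(\<Sum>j\<in>J. \<bar>B $$ (i, j)\<bar>) \<le> (\<Sum>j\<in>{..<n} - {i}. \<bar>B $$ (i, j)\<bar>)"
    using assms(3) by (intro sum_mono2) auto
  then show ?thesis
    using assms(1,2) by (force simp: dominant_rows_def)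
qed

lemma dominant_rows_diag_pos:
  assumes "dominant_rows n B" "i < n"
  shows "0 < B $$ (i, i)"
  using dominant_rows_partial_sum[OF assms, of "{}"] by simp

lemma r_plus_upper:
  assumes "j < dim_col M" "j \<noteq> i"
  shows "M $$ (i, j) \<le> r_plus M i"
  unfolding r_plus_def using assms by (intro Max_ge) auto

text \<open>
  The value \<open>0\<close> lies below the mean because the row sum is positive, the off-diagonal entries by
  the second half of the \<open>B\<close>-matrix condition.
\<close>

lemma r_plus_less_row_mean:
  assumes "M \<in> carrier_mat n n" "B_matrix M" "i < n"
  shows "real n * r_plus M i < (\<Sum>k<n. M $$ (i, k))"
proof -
  let ?s = "\<Sum>k<n. M $$ (i, k)"
  have dims: "dim_row M = n" "dim_col M = n"
    using assms(1) by auto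
  have row: "?s > 0" "\<And>j. j < n \<Longrightarrow> j \<noteq> i \<Longrightarrow> M $$ (i, j) < (1 / real n) * ?s"
    using assms(2,3) unfolding B_matrix_def dims by blast+
  have "r_plus M i < (1 / real n) * ?s"
    unfolding r_plus_def dims using row assms(3) by (subst Max_less_iff) auto
  then show ?thesis
    using assms(3) by (simp add: field_simps)
qed

lemma B_plus_dominant:
  assumes "M \<in> carrier_mat n n" "B_matrix M"
  shows "dominant_rows n (B_plus M)"
  unfolding dominant_rows_def
proof (intro conjI allI impI)
  show "dim_row (B_plus M) = n"
    using assms(1) by (simp add: B_plus_def)
next
  fix i assume i: "i < n"
  have dims: "dim_row M = n" "dim_col M = n"
    using assms(1) by auto
  have entry: "B_plus M $$ (i, j) = M $$ (i, j) - r_plus M i" if "j < n" for j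
    using that i dims by (simp add: B_plus_def)
  have "(\<Sum>j\<in>{..<n} - {i}. \<bar>B_plus M $$ (i, j)\<bar>) = (\<Sum>j\<in>{..<n} - {i}. - (B_plus M $$ (i, j)))"
    using r_plus_upper[of _ M i] dims by (intro sum.cong) (auto simp: entry)
  also have "\<dots> = B_plus M $$ (i, i) - (\<Sum>j<n. B_plus M $$ (i, j))"
    using i by (simp add: sum_negf sum.remove[of "{..<n}" i])
  also have "(\<Sum>j<n. B_plus M $$ (i, j)) = (\<Sum>j<n. M $$ (i, j)) - real n * r_plus M i"
    by (simp add: entry sum_subtractf)
  finally show "(\<Sum>j\<in>{..<n} - {i}. \<bar>B_plus M $$ (i, j)\<bar>) < B_plus M $$ (i, i)"
    using r_plus_less_row_mean[OF assms i] by linarith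
qed

lemma l_max_upper:
  assumes "dominant_rows n B" "k \<le> i" "i < n"
  shows "(1 / B $$ (i, i)) * (\<Sum>j\<in>{k..<n} - {i}. \<bar>B $$ (i, j)\<bar>) \<le> l_max B k"
proof -
  have "dim_row B = n"
    using assms(1) by (simp add: dominant_rows_def)
  moreover have "\<bar>B $$ (i, i)\<bar> = B $$ (i, i)"
    using dominant_rows_diag_pos[OF assms(1,3)] by simp
  ultimately show ?thesis
    unfolding l_max_def using assms(2,3) by (intro Max_ge) (auto intro!: exI[of _ i])
qed

lemma l_max_le_one:
  assumes "dominant_rows n B" "k < n"
  shows "l_max B k \<le> 1"
proof -
  have "dim_row B = n"
    using assms(1) by (simp add: dominant_rows_def)
  moreover have "(1 / \<bar>B $$ (i, i)\<bar>) * (\<Sum>j\<in>{k..<n} - {i}. \<bar>B $$ (i, j)\<bar>) \<le> 1" if "i < n" for i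
  proof -
    have "(\<Sum>j\<in>{k..<n} - {i}. \<bar>B $$ (i, j)\<bar>) < B $$ (i, i)"
      using assms(1) that by (intro dominant_rows_partial_sum) auto
    then show ?thesis
      using dominant_rows_diag_pos[OF assms(1) that] by simp
  qed
  ultimately show ?thesis
    unfolding l_max_def using assms(2) by (subst Max_le_iff) auto
qed

text \<open>
  Numerator and subtracted sum together form a partial sum of the off-diagonal part of row \<open>k\<close>,
  which lies strictly below \<open>b\<^sub>k\<^sub>k\<close>.
\<close>

lemma m_tilde_ratio_le_one:
  assumes "dominant_rows n B" "k < n" "h < n" "h \<noteq> k"
  shows "\<bar>B $$ (k, h)\<bar> / (B $$ (k, k) - (\<Sum>l\<in>{h<..<n} - {k}. \<bar>B $$ (k, l)\<bar>)) \<le> 1"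
proof -
  have "(\<Sum>l\<in>insert h ({h<..<n} - {k}). \<bar>B $$ (k, l)\<bar>) < B $$ (k, k)"
    using assms by (intro dominant_rows_partial_sum) auto
  then have "\<bar>B $$ (k, h)\<bar> < B $$ (k, k) - (\<Sum>l\<in>{h<..<n} - {k}. \<bar>B $$ (k, l)\<bar>)"
    by simp
  then show ?thesis
    by (auto simp: divide_le_eq_1)
qed

lemma m_tilde_le_l_max:
  assumes dom: "dominant_rows n B" and "i < k" "k < n"
  shows "m_tilde B k i \<le> l_max B i"
proof -
  have dim: "dim_row B = n"
    using dom by (simp add: dominant_rows_def)
  define R where "R l = Max {\<bar>B $$ (l, h)\<bar> /
      (B $$ (l, l) - (\<Sum>s\<in>{h<..<n} - {l}. \<bar>B $$ (l, s)\<bar>)) |h. h < n \<and> h \<noteq> l}" for l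
  have R_le: "R l \<le> 1" if "l < n" for l
  proof -
    (* The maximum is over a nonempty set: i < k < n gives at least two indices. *)
    have "\<exists>h<n. h \<noteq> l"
      using assms(2,3) by (metis less_trans less_irrefl)
    then show ?thesis
      unfolding R_def using m_tilde_ratio_le_one[OF dom that] by (subst Max_le_iff) auto
  qed
  have "\<bar>B $$ (k, i)\<bar> + (\<Sum>l\<in>{i<..<n} - {k}. \<bar>B $$ (k, l)\<bar> * R l)
      \<le> \<bar>B $$ (k, i)\<bar> + (\<Sum>l\<in>{i<..<n} - {k}. \<bar>B $$ (k, l)\<bar>)"
    using R_le by (intro add_left_mono sum_mono) (auto intro!: mult_left_le)
  also have "\<dots> = (\<Sum>l\<in>insert i ({i<..<n} - {k}). \<bar>B $$ (k, l)\<bar>)"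
    by simp
  also have "insert i ({i<..<n} - {k}) = {i..<n} - {k}"
    using assms(2,3) by auto
  finally have "m_tilde B k i \<le> (1 / B $$ (k, k)) * (\<Sum>l\<in>{i..<n} - {k}. \<bar>B $$ (k, l)\<bar>)"
    unfolding m_tilde_def dim R_def
    using dominant_rows_diag_pos[OF dom assms(3)] by (intro mult_left_mono) auto
  also have "\<dots> \<le> l_max B i"
    using assms by (intro l_max_upper) auto
  finally show ?thesis .
qed

lemma beta_bar_pos:
  assumes "dominant_rows n B" "i < n"
  shows "0 < beta_bar B i"
proof -
  have dim: "dim_row B = n"
    using assms(1) by (simp add: dominant_rows_def)
  have "(\<Sum>j\<in>{i<..<n}. \<bar>B $$ (i, j)\<bar> * l_max B i) \<le> (\<Sum>j\<in>{i<..<n}. \<bar>B $$ (i, j)\<bar>)"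
    using l_max_le_one[OF assms] by (intro sum_mono) (auto intro!: mult_left_le)
  also have "\<dots> < B $$ (i, i)"
    using assms by (intro dominant_rows_partial_sum) auto
  finally show ?thesis
    by (simp add: beta_bar_def dim)
qed

lemma beta_bar_le_beta_hat:
  assumes "dominant_rows n B"
  shows "beta_bar B i \<le> beta_hat B i"
proof -
  have "dim_row B = n"
    using assms by (simp add: dominant_rows_def)
  then show ?thesis
    unfolding beta_bar_def beta_hat_def
    using m_tilde_le_l_max[OF assms] by (intro diff_left_mono sum_mono mult_left_mono) auto
qed

theorem theorem2p6:
  fixes n :: nat and M B :: "real mat"
  assumes "n \<ge> 2"
    and "M \<in> carrier_mat n n"
    and "B_matrix M"
    and "B = B_plus M"
  shows "(\<Sum>i<n. (real n - 1) / min (beta_hat B i) 1 * (\<Prod>j<i. B $$ (j, j) / beta_bar B j))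
       \<le> (\<Sum>i<n. (real n - 1) / min (beta_bar B i) 1 * (\<Prod>j<i. B $$ (j, j) / beta_bar B j))"
proof (intro sum_mono mult_right_mono)
  have dom: "dominant_rows n B"
    using B_plus_dominant assms(2-4) by simp
  fix i assume "i \<in> {..<n}"
  then have i: "i < n" by simp
  show "0 \<le> (\<Prod>j<i. B $$ (j, j) / beta_bar B j)"
    using i dominant_rows_diag_pos[OF dom] beta_bar_pos[OF dom]
    by (intro prod_nonneg) (simp add: less_imp_le)
  show "(real n - 1) / min (beta_hat B i) 1 \<le> (real n - 1) / min (beta_bar B i) 1"
    using assms(1) beta_bar_pos[OF dom i] beta_bar_le_beta_hat[OF dom, of i]
    by (intro divide_left_mono) auto
qed

end
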